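(* Let $\mathcal{F}_0$ be the unit ball of some normed space of real-valued functions of the covariate. For $f\in\mathcal{F}_0$ put $f^0(t,x)=(1-t)f(x)$ and $f^1(t,x)=tf(x)$, and let $\mathcal{F}=\{f^t: f\in\mathcal{F}_0,\ t\in\{0,1\}\}$. For $\lambda>0$ let $$\mathbf{w}(\lambda)=(\mathbf{w}^0(\lambda),\mathbf{w}^1(\lambda))=\operatorname*{arg\,min}_{\mathbf{w}\in\Lambda_{0,1}}\ \mathrm{IPM}^2_{\mathcal{F}}\big(\hat P^{\mathbf{w}}_{T,X},\hat Q_{T,X}\big)+\lambda\|\mathbf{w}\|_2^2,$$ where $\Lambda_{0,1}=\{\mathbf{w}=(\mathbf{w}^0,\mathbf{w}^1)\ge0:\ \sum_{i=1}^{n_t}w_i^t=n_t/n,\ t\in\{0,1\}\}$ and $\hat Q_{T,X}=\hat P_T\otimes\hat P_{X|T=1}$. Let $$\tilde{\mathbf{w}}^0(\lambda)=\operatorname*{arg\,min}_{\tilde{\mathbf{w}}\in\Lambda_{n_0}}\ \mathrm{IPM}^2_{\mathcal{F}_0}\big(\hat P^{\tilde{\mathbf{w}}}_{X|T=0},\hat P_{X|T=1}\big)+\lambda\|\tilde{\mathbf{w}}\|_2^2$$ be the generalized optimal matching (GOM) weights. Then $$\mathbf{w}^0(\lambda)=\frac{n_0}{n}\tilde{\mathbf{w}}^0(\lambda)\qquad\text{and}\qquad \mathbf{w}^1(\lambda)=n^{-1}\mathbf{1},$$ and the two methods return the same estimator $\tilde\mu(t)$ for $t\in\{0,1\}$;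 here GOM returns $\tilde\mu(0)=\sum_{i=1}^{n_0}\tilde w_i^0(\lambda)Y_i$ and $\tilde\mu(1)=\frac1{n_1}\sum_{i=n_0+1}^{n}Y_i$, and the method based on $\mathbf{w}(\lambda)$ returns the function $g:\{0,1\}\to\mathbb{R}$ minimizing $\sum_{i=1}^n w_i(\lambda)(Y_i-g(T_i))^2$ over all functions on $\{0,1\}$, that is, the weighted average of $Y$ within each treatment group.
   Context: The data are $(T_i,X_i,Y_i)_{i=1}^n$ with binary treatment $T_i\in\{0,1\}$, covariates $X_i$ and real outcomes $Y_i$. The observations are ordered so that the first $n_0>0$ observations are the control group ($T_i=0$) and the last $n_1=n-n_0>0$ are the treated group ($T_i=1$). A weight vector $\mathbf{w}\in\mathbb{R}^n$ is split as $\mathbf{w}=(\mathbf{w}^0,\mathbf{w}^1)$, with $\mathbf{w}^0$ its first $n_0$ entries and $\mathbf{w}^1$ its last $n_1$ entries. $\Lambda_m=\{\mathbf{w}\in\mathbb{R}^m:\mathbf{w}\ge0,\ \sum_iw_i=1\}$. $\hat P^{\mathbf{w}}_{T,X}=\sum_{i=1}^nw_i\delta_{(T_i,X_i)}$, $\hat P_T=\frac1n\sum_{i=1}^n\delta_{T_i}$, $\hat P^{\tilde{\mathbf{w}}}_{X|T=0}=\sum_{i=1}^{n_0}\tilde w_i\delta_{X_i}$, $\hat P_{X|T=1}=n_1^{-1}\sum_{i=n_0+1}^n\delta_{X_i}$, where $\delta_z$ is the Dirac mass at $z$. For a class $\mathcal{F}$ of measurable functions and probability measures $P_0,Q_0$,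 $\mathrm{IPM}_{\mathcal{F}}(P_0,Q_0)=\sup_{f\in\mathcal{F}}|\mathbb{E}_{Z\sim P_0}[f(Z)]-\mathbb{E}_{Z\sim Q_0}[f(Z)]|$. $\mathbf{1}$ is the all-ones vector. GOM estimates the expected potential outcomes $\mathbb{E}[Y(t)\mid T=1]$ for the treated group. *)

theory Defs
  imports "HOL-Analysis.Analysis"
begin

text \<open>
  The control units are indexed by \<open>'c\<close> and the treated units by \<open>'t\<close>, so that
  \<open>n\<^sub>0 = CARD('c)\<close>, \<open>n\<^sub>1 = CARD('t)\<close>, and the whole sample is indexed by \<open>'c + 't\<close>, the
  constructors \<open>Inl\<close> and \<open>Inr\<close> expressing that the controls come first.
\<close>

definition control_block :: "real ^ ('c::finite + 't::finite) \<Rightarrow> real ^ 'c" where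
  "control_block w = (\<chi> i. w $ Inl i)"

definition treated_block :: "real ^ ('c::finite + 't::finite) \<Rightarrow> real ^ 't" where
  "treated_block w = (\<chi> j. w $ Inr j)"

definition weight_simplex :: "(real ^ 'm::finite) set" where
  "weight_simplex = {w. (\<forall>i. 0 \<le> w $ i) \<and> (\<Sum>i\<in>UNIV. w $ i) = 1}"

definition blockwise_simplex :: "(real ^ ('c::finite + 't::finite)) set" where
  "blockwise_simplex =
     {w. (\<forall>i. 0 \<le> w $ i) \<and>
         (\<Sum>i\<in>UNIV. control_block w $ i) = real CARD('c) / real CARD('c + 't) \<and>
         (\<Sum>j\<in>UNIV. treated_block w $ j) = real CARD('t) / real CARD('c + 't)}"

text \<open>The measure \<open>\<Sum>i. w\<^sub>i \<delta>\<^bsub>z i\<^esub>\<close> for nonnegative weights (negative ones are truncated to 0 by \<open>ennreal\<close>).\<close>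

definition weighted_empirical :: "'z measure \<Rightarrow> real ^ 'i::finite \<Rightarrow> ('i \<Rightarrow> 'z) \<Rightarrow> 'z measure" where
  "weighted_empirical M w z = distr (point_measure UNIV (\<lambda>i. ennreal (w $ i))) M z"

lemma emeasure_weighted_empirical:
  fixes w :: "real ^ 'i::finite"
  assumes "\<And>i. z i \<in> space M" and "A \<in> sets M"
  shows "emeasure (weighted_empirical M w z) A
    = (\<Sum>i\<in>UNIV. ennreal (w $ i) * indicator A (z i))"
proof -
  have "emeasure (weighted_empirical M w z) A = (\<Sum>i\<in>z -` A. ennreal (w $ i))"
    unfolding weighted_empirical_def using assms
    by (subst emeasure_distr)
       (auto simp: measurable_def space_point_measure sets_point_measure
          emeasure_point_measure_finite)
  also have "\<dots> = (\<Sum>i\<in>UNIV. ennreal (w $ i) * indicator A (z i))"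
    by (rule sum.mono_neutral_cong_left) (auto simp: indicator_def)
  finally show ?thesis .
qed

definition uniform_empirical :: "'z measure \<Rightarrow> ('i::finite \<Rightarrow> 'z) \<Rightarrow> 'z measure" where
  "uniform_empirical M z = weighted_empirical M (\<chi> i. 1 / real CARD('i)) z"

text \<open>Extended-valued: over an arbitrary unit ball the supremum can be infinite.\<close>

definition ipm :: "('z \<Rightarrow> real) set \<Rightarrow> 'z measure \<Rightarrow> 'z measure \<Rightarrow> ennreal" where
  "ipm \<F> P Q = (SUP f\<in>\<F>. ennreal \<bar>integral\<^sup>L P f - integral\<^sup>L Q f\<bar>)"

locale normed_function_space =
  fixes V :: "('x \<Rightarrow> real) set" and N :: "('x \<Rightarrow> real) \<Rightarrow> real"
  assumes zero_mem: "(\<lambda>_. 0) \<in> V"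
    and add_mem: "f \<in> V \<Longrightarrow> g \<in> V \<Longrightarrow> (\<lambda>x. f x + g x) \<in> V"
    and scale_mem: "f \<in> V \<Longrightarrow> (\<lambda>x. a * f x) \<in> V"
    and norm_nonneg: "f \<in> V \<Longrightarrow> 0 \<le> N f"
    and norm_eq_zero_iff: "f \<in> V \<Longrightarrow> N f = 0 \<longleftrightarrow> f = (\<lambda>_. 0)"
    and norm_scale: "f \<in> V \<Longrightarrow> N (\<lambda>x. a * f x) = \<bar>a\<bar> * N f"
    and norm_triangle: "f \<in> V \<Longrightarrow> g \<in> V \<Longrightarrow> N (\<lambda>x. f x + g x) \<le> N f + N g"

definition function_unit_ball ::
    "('x \<Rightarrow> real) set \<Rightarrow> (('x \<Rightarrow> real) \<Rightarrow> real) \<Rightarrow> ('x \<Rightarrow> real) set" where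
  "function_unit_ball V N = {f \<in> V. N f \<le> 1}"

text \<open>\<open>arm_lift t f\<close> is \<open>f\<^sup>t\<close>; only \<open>t \<in> {0, 1}\<close> is used.\<close>

definition arm_lift :: "nat \<Rightarrow> ('x \<Rightarrow> real) \<Rightarrow> nat \<times> 'x \<Rightarrow> real" where
  "arm_lift t f = (\<lambda>(s, x). if t = 0 then (1 - real s) * f x else real s * f x)"

definition arm_class :: "('x \<Rightarrow> real) set \<Rightarrow> (nat \<times> 'x \<Rightarrow> real) set" where
  "arm_class \<F>\<^sub>0 = {arm_lift t f | t f. t \<in> {0, 1} \<and> f \<in> \<F>\<^sub>0}"

abbreviation treatment_space :: "nat measure" where
  "treatment_space \<equiv> count_space {0, 1}"

definition joint_objective ::
    "'x measure \<Rightarrow> ('x \<Rightarrow> real) set \<Rightarrow> real \<Rightarrow> ('c::finite + 't::finite \<Rightarrow> nat) \<Rightarrow> ('c + 't \<Rightarrow> 'x) \<Rightarrow>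
     real ^ ('c + 't) \<Rightarrow> ennreal" where
  "joint_objective M \<F>\<^sub>0 l T X w =
     (ipm (arm_class \<F>\<^sub>0)
        (weighted_empirical (treatment_space \<Otimes>\<^sub>M M) w (\<lambda>i. (T i, X i)))
        (uniform_empirical treatment_space T \<Otimes>\<^sub>M uniform_empirical M (\<lambda>j. X (Inr j))))\<^sup>2
     + ennreal (l * (norm w)\<^sup>2)"

definition gom_ipm ::
    "'x measure \<Rightarrow> ('x \<Rightarrow> real) set \<Rightarrow> ('c::finite + 't::finite \<Rightarrow> 'x) \<Rightarrow> real ^ 'c \<Rightarrow> ennreal" where
  "gom_ipm M \<F>\<^sub>0 X v =
     ipm \<F>\<^sub>0 (weighted_empirical M v (\<lambda>i. X (Inl i))) (uniform_empirical M (\<lambda>j. X (Inr j)))"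

definition gom_objective ::
    "'x measure \<Rightarrow> ('x \<Rightarrow> real) set \<Rightarrow> real \<Rightarrow> ('c::finite + 't::finite \<Rightarrow> 'x) \<Rightarrow> real ^ 'c \<Rightarrow> ennreal" where
  "gom_objective M \<F>\<^sub>0 l X v = (gom_ipm M \<F>\<^sub>0 X v)\<^sup>2 + ennreal (l * (norm v)\<^sup>2)"

definition minimizers :: "('a \<Rightarrow> 'b::ord) \<Rightarrow> 'a set \<Rightarrow> 'a set" where
  "minimizers h S = {x. is_arg_min h (\<lambda>y. y \<in> S) x}"

definition weighted_square_loss ::
    "('i::finite \<Rightarrow> nat) \<Rightarrow> ('i \<Rightarrow> real) \<Rightarrow> real ^ 'i \<Rightarrow> (nat \<Rightarrow> real) \<Rightarrow> real" where
  "weighted_square_loss T Y w g = (\<Sum>i\<in>UNIV. w $ i * (Y i - g (T i))\<^sup>2)"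

definition gom_estimator ::
    "('c::finite + 't::finite \<Rightarrow> real) \<Rightarrow> real ^ 'c \<Rightarrow> nat \<Rightarrow> real" where
  "gom_estimator Y v = (\<lambda>t\<in>{0, 1}.
     if t = 0 then (\<Sum>i\<in>UNIV. v $ i * Y (Inl i))
     else (\<Sum>j\<in>UNIV. Y (Inr j)) / real CARD('t))"

end

theory Submission
  imports Defs
begin

text \<open>
  Write \<open>a = n\<^sub>0 / n\<close>, \<open>w\<^sup>0 = a v\<close> with \<open>v\<close> in the simplex, and \<open>G\<close> for the GOM objective. Testing
  against \<open>f\<^sup>0\<close> alone gives \<open>a\<close> times the GOM discrepancy of \<open>v\<close>, while the discrepancy of every \<open>f\<^sup>1\<close>
  vanishes at \<open>w\<^sup>1 = 1/n\<close>. Since \<open>\<parallel>w\<^sup>1\<parallel>\<^sup>2 = n\<^sub>1 / n\<^sup>2 + \<parallel>w\<^sup>1 - 1/n\<parallel>\<^sup>2\<close> on the block simplex, the joint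
  objective is at least \<open>a\<^sup>2 G(v) + \<lambda> n\<^sub>1 / n\<^sup>2 + \<lambda> \<parallel>w\<^sup>1 - 1/n\<parallel>\<^sup>2\<close>, with equality at \<open>w\<^sup>1 = 1/n\<close>. So
  extending a GOM minimizer by \<open>1/n\<close> minimizes the joint objective, even when both are identically
  infinite; if \<open>G\<close> is finite somewhere, every joint minimizer has this form. A minimizer of \<open>G\<close> exists
  because \<open>G\<close> is a supremum of continuous functions on a compact set, and finiteness makes it unique by strict
  convexity of the squared norm.
\<close>

section \<open>Sums and norms over the control and treated blocks\<close>

lemma sum_UNIV_sum_type:
  fixes f :: "'a::finite + 'b::finite \<Rightarrow> 'c::comm_monoid_add"
  shows "(\<Sum>i\<in>UNIV. f i) = (\<Sum>i\<in>UNIV. f (Inl i)) + (\<Sum>j\<in>UNIV. f (Inr j))"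
  using sum.Plus[of UNIV UNIV f] by simp

lemma norm_vec_power2: "(norm (w :: real ^ 'i))\<^sup>2 = (\<Sum>i\<in>UNIV. (w $ i)\<^sup>2)"
  unfolding power2_norm_eq_inner inner_vec_def by (simp add: power2_eq_square)

lemma norm_blocks_power2:
  "(norm w)\<^sup>2 = (norm (control_block w))\<^sup>2 + (norm (treated_block w))\<^sup>2"
  by (simp add: norm_vec_power2 sum_UNIV_sum_type control_block_def treated_block_def)

lemma blocks_eqI:
  assumes "control_block w = control_block u" "treated_block w = treated_block u"
  shows "w = u"
proof -
  have "w $ i = u $ i" for i
    using assms by (cases i) (auto simp: control_block_def treated_block_def vec_eq_iff)
  then show ?thesis
    by (simp add: vec_eq_iff)
qed

subsection \<open>Integrals against empirical measures\<close>

lemma sets_weighted_empirical [simp, measurable_cong]: "sets (weighted_empirical M w z) = sets M"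
  by (simp add: weighted_empirical_def)

lemma space_weighted_empirical [simp]: "space (weighted_empirical M w z) = space M"
  by (simp add: weighted_empirical_def)

lemma measurable_point_measure_UNIV:
  assumes "\<And>i. z i \<in> space M"
  shows "z \<in> measurable (point_measure UNIV p) M"
  using assms by (auto simp: measurable_def space_point_measure sets_point_measure)

lemma finite_measure_weighted_empirical:
  assumes "\<And>i. z i \<in> space M"
  shows "finite_measure (weighted_empirical M w z)"
proof (rule finite_measureI)
  have "emeasure (weighted_empirical M w z) (space M) < top"
    using assms by (subst emeasure_weighted_empirical) (auto simp: less_top[symmetric])
  then show "emeasure (weighted_empirical M w z) (space (weighted_empirical M w z)) \<noteq> \<infinity>"
    by simp
qed

lemma integrable_weighted_empirical:
  fixes f :: "'z \<Rightarrow> real"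
  assumes "\<And>i. z i \<in> space M" "f \<in> borel_measurable M"
  shows "integrable (weighted_empirical M w z) f"
  unfolding weighted_empirical_def
  using assms(2)
  by (subst integrable_distr_eq)
     (auto intro!: measurable_point_measure_UNIV integrable_point_measure_finite assms(1))

text \<open>Nonnegative weights pass through \<open>ennreal\<close> unchanged, so the truncation in
  the point masses does not affect the sum.\<close>

lemma integral_weighted_empirical:
  fixes f :: "'z \<Rightarrow> real"
  assumes "\<And>i. z i \<in> space M" "f \<in> borel_measurable M" "\<And>i. 0 \<le> w $ i"
  shows "integral\<^sup>L (weighted_empirical M w z) f = (\<Sum>i\<in>UNIV. w $ i * f (z i))"
proof -
  have "integral\<^sup>L (weighted_empirical M w z) f
      = integral\<^sup>L (point_measure UNIV (\<lambda>i. ennreal (w $ i))) (\<lambda>i. f (z i))"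
    unfolding weighted_empirical_def
    by (rule integral_distr) (auto intro!: measurable_point_measure_UNIV assms)
  also have "\<dots> = (\<Sum>i\<in>UNIV. w $ i * f (z i))"
    using assms(3) by (subst lebesgue_integral_point_measure_finite) auto
  finally show ?thesis .
qed

lemma integral_uniform_empirical:
  fixes f :: "'z \<Rightarrow> real" and z :: "'i::finite \<Rightarrow> 'z"
  assumes "\<And>i. z i \<in> space M" "f \<in> borel_measurable M"
  shows "integral\<^sup>L (uniform_empirical M z) f = (\<Sum>i\<in>UNIV. f (z i)) / real CARD('i)"
  unfolding uniform_empirical_def
  using assms by (subst integral_weighted_empirical) (auto simp: sum_divide_distrib)

text \<open>Fubini reduces the product to two successive averages. Integrability is free, since both
  factors are finite sums of point masses and only measurability of the iterated integrands has to
  be checked.\<close>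

lemma integral_pair_uniform_empirical:
  fixes f :: "'y \<times> 'z \<Rightarrow> real" and a :: "'i::finite \<Rightarrow> 'y" and b :: "'j::finite \<Rightarrow> 'z"
  assumes a: "\<And>i. a i \<in> space M" and b: "\<And>j. b j \<in> space L"
    and f: "f \<in> borel_measurable (M \<Otimes>\<^sub>M L)"
  shows "integral\<^sup>L (uniform_empirical M a \<Otimes>\<^sub>M uniform_empirical L b) f
    = (\<Sum>i\<in>UNIV. (\<Sum>j\<in>UNIV. f (a i, b j)) / real CARD('j)) / real CARD('i)"
proof -
  let ?P = "uniform_empirical M a" and ?Q = "uniform_empirical L b"
  interpret P: finite_measure ?P
    unfolding uniform_empirical_def by (rule finite_measure_weighted_empirical) (rule a)
  interpret Q: finite_measure ?Q
    unfolding uniform_empirical_def by (rule finite_measure_weighted_empirical) (rule b)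
  interpret PQ: pair_sigma_finite ?P ?Q ..
  have sets [measurable_cong, simp]: "sets ?P = sets M" "sets ?Q = sets L"
    and space: "space ?P = space M" "space ?Q = space L"
    by (simp_all add: uniform_empirical_def)
  have f' [measurable]: "f \<in> borel_measurable (?P \<Otimes>\<^sub>M ?Q)"
    using f by (simp cong: measurable_cong_sets sets_pair_measure_cong)
  have int: "integrable (?P \<Otimes>\<^sub>M ?Q) f"
  proof (rule PQ.Fubini_integrable)
    have "(\<lambda>x. \<integral>y. norm (f (x, y)) \<partial>?Q) \<in> borel_measurable ?P"
      by measurable
    then show "integrable ?P (\<lambda>x. \<integral>y. norm (f (x, y)) \<partial>?Q)"
      unfolding uniform_empirical_def
      by (intro integrable_weighted_empirical a) (simp add: uniform_empirical_def cong: measurable_cong_sets)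
    have "integrable ?Q (\<lambda>y. f (x, y))" if "x \<in> space ?P" for x
      unfolding uniform_empirical_def
      using that f space by (intro integrable_weighted_empirical b) simp
    then show "AE x in ?P. integrable ?Q (\<lambda>y. f (x, y))"
      by (intro AE_I2)
  qed (rule f')
  have "integral\<^sup>L (?P \<Otimes>\<^sub>M ?Q) f = (\<integral>x. (\<integral>y. f (x, y) \<partial>?Q) \<partial>?P)"
    using PQ.integral_fst'[OF int] by simp
  also have "\<dots> = (\<Sum>i\<in>UNIV. \<integral>y. f (a i, y) \<partial>?Q) / real CARD('i)"
  proof (rule integral_uniform_empirical[OF a])
    have "(\<lambda>x. \<integral>y. f (x, y) \<partial>?Q) \<in> borel_measurable ?P"
      by measurable
    then show "(\<lambda>x. \<integral>y. f (x, y) \<partial>?Q) \<in> borel_measurable M"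
      by (simp cong: measurable_cong_sets)
  qed
  also have "(\<Sum>i\<in>UNIV. \<integral>y. f (a i, y) \<partial>?Q)
      = (\<Sum>i\<in>UNIV. (\<Sum>j\<in>UNIV. f (a i, b j)) / real CARD('j))"
    using measurable_compose[OF measurable_Pair1'[OF a] f]
    by (intro sum.cong refl arg_cong2[where f = "(/)"] integral_uniform_empirical[OF b]) simp_all
  finally show ?thesis .
qed

subsection \<open>Discrepancies as suprema of affine functions of the weights\<close>

lemma ipm_cong:
  assumes "\<And>f. f \<in> \<F> \<Longrightarrow> integral\<^sup>L P f - integral\<^sup>L Q f = d f"
  shows "ipm \<F> P Q = (SUP f\<in>\<F>. ennreal \<bar>d f\<bar>)"
  unfolding ipm_def using assms by (intro SUP_cong) auto

text \<open>The signed GOM discrepancy of one test function. Being a formula in the weights rather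
  than an integral, it is affine in \<open>v\<close> on the whole space, also where \<open>v\<close>
  has negative entries.\<close>

definition imbalance :: "('c::finite + 't::finite \<Rightarrow> 'x) \<Rightarrow> real ^ 'c \<Rightarrow> ('x \<Rightarrow> real) \<Rightarrow> real" where
  "imbalance X v f = (\<Sum>i\<in>UNIV. v $ i * f (X (Inl i))) - (\<Sum>j\<in>UNIV. f (X (Inr j))) / real CARD('t)"

lemma gom_ipm_eq_SUP:
  fixes X :: "'c::finite + 't::finite \<Rightarrow> 'x"
  assumes "\<F> \<subseteq> borel_measurable M" "\<And>i. X i \<in> space M" "\<And>i. 0 \<le> v $ i"
  shows "gom_ipm M \<F> X v = (SUP f\<in>\<F>. ennreal \<bar>imbalance X v f\<bar>)"
  unfolding gom_ipm_def imbalance_def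
  using assms(1)
  by (intro ipm_cong)
     (auto simp: integral_weighted_empirical integral_uniform_empirical assms(2,3))

text \<open>The subtracted double average is the integral of \<open>h\<close> against the product of
  the treatment marginal and the treated covariate distribution; the first coordinate runs over the
  whole sample, the second over treated units only.\<close>

definition joint_discrepancy ::
    "('c::finite + 't::finite \<Rightarrow> nat) \<Rightarrow> ('c + 't \<Rightarrow> 'x) \<Rightarrow> real ^ ('c + 't) \<Rightarrow> (nat \<times> 'x \<Rightarrow> real) \<Rightarrow> real" where
  "joint_discrepancy T X w h = (\<Sum>i\<in>UNIV. w $ i * h (T i, X i))
     - (\<Sum>i\<in>(UNIV :: ('c + 't) set). (\<Sum>j\<in>UNIV. h (T i, X (Inr j))) / real CARD('t)) / real CARD('c + 't)"

lemma arm_lift_measurable: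
  assumes [measurable]: "f \<in> borel_measurable M"
  shows "arm_lift t f \<in> borel_measurable (treatment_space \<Otimes>\<^sub>M M)"
proof -
  have [measurable]: "real \<in> borel_measurable treatment_space"
    by simp
  show ?thesis
    unfolding arm_lift_def by measurable
qed

lemma joint_objective_eq_SUP:
  fixes X :: "'c::finite + 't::finite \<Rightarrow> 'x"
  assumes "\<F> \<subseteq> borel_measurable M" "\<And>i. X i \<in> space M" "\<And>i. 0 \<le> w $ i"
    and "\<And>i. T i \<in> {0, 1}"
  shows "joint_objective M \<F> l T X w =
    (SUP h\<in>arm_class \<F>. ennreal \<bar>joint_discrepancy T X w h\<bar>)\<^sup>2 + ennreal (l * (norm w)\<^sup>2)"
proof -
  have "h \<in> borel_measurable (treatment_space \<Otimes>\<^sub>M M)" if h: "h \<in> arm_class \<F>" for h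
  proof -
    obtain t f where "h = arm_lift t f" "f \<in> \<F>"
      using h unfolding arm_class_def by blast
    then show ?thesis
      using arm_lift_measurable assms(1) by blast
  qed
  then have "ipm (arm_class \<F>) (weighted_empirical (treatment_space \<Otimes>\<^sub>M M) w (\<lambda>i. (T i, X i)))
        (uniform_empirical treatment_space T \<Otimes>\<^sub>M uniform_empirical M (\<lambda>j. X (Inr j)))
     = (SUP h\<in>arm_class \<F>. ennreal \<bar>joint_discrepancy T X w h\<bar>)"
    unfolding joint_discrepancy_def using assms(2-4)
    by (intro ipm_cong)
       (simp add: integral_weighted_empirical integral_pair_uniform_empirical space_pair_measure)
  then show ?thesis
    by (simp add: joint_objective_def)
qed

text \<open>A lift to one arm vanishes on the other arm, in the weighted sample and in the target
  alike. The target gives the control arm mass n0/n, the factor also carried by the control weights;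
  it gives the treated arm mass n1/n spread evenly, which weights 1/n reproduce exactly.\<close>

lemma joint_discrepancy_arm_lift:
  fixes X :: "'c::finite + 't::finite \<Rightarrow> 'x"
  assumes "\<And>i. T (Inl i) = 0" "\<And>j. T (Inr j) = 1"
  shows joint_discrepancy_arm_lift_0:
      "control_block w = (real CARD('c) / real CARD('c + 't)) *\<^sub>R v \<Longrightarrow>
       joint_discrepancy T X w (arm_lift 0 f)
         = real CARD('c) / real CARD('c + 't) * imbalance X v f"
    and joint_discrepancy_arm_lift_1:
      "treated_block w = (\<chi> j. 1 / real CARD('c + 't)) \<Longrightarrow>
       joint_discrepancy T X w (arm_lift 1 f) = 0"
proof -
  assume "control_block w = (real CARD('c) / real CARD('c + 't)) *\<^sub>R v"
  then have "w $ Inl i = real CARD('c) / real CARD('c + 't) * v $ i" for i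
    by (auto simp: control_block_def vec_eq_iff)
  then show "joint_discrepancy T X w (arm_lift 0 f)
      = real CARD('c) / real CARD('c + 't) * imbalance X v f"
    by (simp add: joint_discrepancy_def imbalance_def arm_lift_def sum_UNIV_sum_type assms
        sum_distrib_left[symmetric] sum_divide_distrib[symmetric] right_diff_distrib mult.assoc)
next
  assume "treated_block w = (\<chi> j. 1 / real CARD('c + 't))"
  then have "w $ Inr j = 1 / real CARD('c + 't)" for j
    by (auto simp: treated_block_def vec_eq_iff)
  then show "joint_discrepancy T X w (arm_lift 1 f) = 0"
    by (simp add: joint_discrepancy_def arm_lift_def sum_UNIV_sum_type assms
        sum_divide_distrib[symmetric])
qed

text \<open>Pythagoras: the block constraint fixes the mean of the treated weights at 1/n, so their
  deviation from the constant vector is orthogonal to it.\<close>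

lemma treated_norm_power2:
  fixes w :: "real ^ ('c::finite + 't::finite)"
  assumes "w \<in> blockwise_simplex"
  shows "(norm (treated_block w))\<^sup>2 = real CARD('t) / (real CARD('c + 't))\<^sup>2
    + (norm (treated_block w - (\<chi> j. 1 / real CARD('c + 't))))\<^sup>2"
proof -
  let ?n = "real CARD('c + 't)" and ?u = "treated_block w"
  have sum: "(\<Sum>j\<in>UNIV. ?u $ j) = real CARD('t) / ?n"
    using assms by (simp add: blockwise_simplex_def)
  have "(\<Sum>j\<in>UNIV. (?u $ j - 1 / ?n)\<^sup>2)
      = (\<Sum>j\<in>UNIV. (?u $ j)\<^sup>2) - 2 / ?n * (\<Sum>j\<in>UNIV. ?u $ j) + real CARD('t) / ?n\<^sup>2"
    by (simp add: power2_diff sum.distrib sum_subtractf sum_distrib_left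
        sum_divide_distrib power_divide)
  also have "\<dots> = (\<Sum>j\<in>UNIV. (?u $ j)\<^sup>2) - real CARD('t) / ?n\<^sup>2"
    unfolding sum by (simp add: power2_eq_square)
  finally show ?thesis
    unfolding norm_vec_power2 by simp
qed

text \<open>Both claims compare the joint supremum \<open>S\<close> with
  \<open>ennreal a * G\<close>: the control lifts alone bound it from below, and at a uniform
  treated block the treated lifts add only zeros.\<close>

lemma joint_objective_ge:
  fixes X :: "'c::finite + 't::finite \<Rightarrow> 'x"
  defines "a \<equiv> real CARD('c) / real CARD('c + 't)"
    and "c \<equiv> real CARD('t) / (real CARD('c + 't))\<^sup>2"
    and "u \<equiv> (\<chi> j. 1 / real CARD('c + 't)) :: real ^ 't"
  assumes \<F>: "\<F> \<subseteq> borel_measurable M" and X: "\<And>i. X i \<in> space M"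
    and T0: "\<And>i. T (Inl i) = 0" and T1: "\<And>j. T (Inr j) = 1" and l: "0 \<le> l"
    and w: "w \<in> blockwise_simplex" and v: "v \<in> weight_simplex"
    and wv: "control_block w = a *\<^sub>R v"
  shows joint_objective_ge_gom:
      "ennreal (a\<^sup>2) * gom_objective M \<F> l X v + ennreal (l * c)
         + ennreal (l * (norm (treated_block w - u))\<^sup>2) \<le> joint_objective M \<F> l T X w"
    and joint_objective_eq_gom:
      "treated_block w = u \<Longrightarrow>
       joint_objective M \<F> l T X w = ennreal (a\<^sup>2) * gom_objective M \<F> l X v + ennreal (l * c)"
proof -
  define r where "r = (norm (treated_block w - u))\<^sup>2"
  define S where "S = (SUP h\<in>arm_class \<F>. ennreal \<bar>joint_discrepancy T X w h\<bar>)"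
  define G where "G = gom_ipm M \<F> X v"
  have a: "0 \<le> a" and c: "0 \<le> c" and r: "0 \<le> r"
    by (simp_all add: a_def c_def r_def)
  have w0: "0 \<le> w $ i" and v0: "0 \<le> v $ k" for i k
    using w v by (auto simp: blockwise_simplex_def weight_simplex_def)
  have T: "T i \<in> {0, 1}" for i
    using T0 T1 by (cases i) auto
  note lift_0 = joint_discrepancy_arm_lift_0[OF T0 T1, folded a_def, OF wv]
  have G: "G = (SUP f\<in>\<F>. ennreal \<bar>imbalance X v f\<bar>)"
    unfolding G_def by (rule gom_ipm_eq_SUP[OF \<F> X v0])
  have aG: "ennreal a * G = (SUP f\<in>\<F>. ennreal \<bar>joint_discrepancy T X w (arm_lift 0 f)\<bar>)"
    unfolding G SUP_mult_left_ennreal using a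
    by (simp add: lift_0 abs_mult ennreal_mult)
  have le: "ennreal a * G \<le> S"
    unfolding aG S_def by (rule SUP_mono) (auto simp: arm_class_def)
  have ge: "S \<le> ennreal a * G" if "treated_block w = u"
    unfolding aG S_def
  proof (rule SUP_least)
    fix h assume "h \<in> arm_class \<F>"
    then consider f where "f \<in> \<F>" "h = arm_lift 0 f" | f where "f \<in> \<F>" "h = arm_lift 1 f"
      by (auto simp: arm_class_def)
    then show "ennreal \<bar>joint_discrepancy T X w h\<bar>
        \<le> (SUP f\<in>\<F>. ennreal \<bar>joint_discrepancy T X w (arm_lift 0 f)\<bar>)"
    proof cases
      case 1
      then show ?thesis by (auto intro: SUP_upper)
    next
      case 2
      \<comment> \<open>The left side is \<open>ennreal 0\<close> here, so it lies below any
        supremum.\<close>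
      then show ?thesis
        using joint_discrepancy_arm_lift_1[OF T0 T1 that[unfolded u_def], of X f]
        by (simp del: One_nat_def)
    qed
  qed
  have J: "joint_objective M \<F> l T X w = S\<^sup>2 + ennreal (l * (norm w)\<^sup>2)"
    unfolding S_def by (rule joint_objective_eq_SUP[OF \<F> X w0 T])
  have "(norm w)\<^sup>2 = a\<^sup>2 * (norm v)\<^sup>2 + c + r"
    unfolding norm_blocks_power2[of w] wv treated_norm_power2[OF w] r_def u_def c_def
    by (simp add: power_mult_distrib)
  \<comment> \<open>All summands are nonnegative, so the real identity splits termwise under
    \<open>ennreal\<close>.\<close>
  then have norm: "ennreal (l * (norm w)\<^sup>2)
      = ennreal (a\<^sup>2) * ennreal (l * (norm v)\<^sup>2) + ennreal (l * c) + ennreal (l * r)"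
    using l a c r by (simp add: ennreal_mult[symmetric] ennreal_plus[symmetric]
        algebra_simps del: ennreal_plus)
  have sq: "(ennreal a * G)\<^sup>2 = ennreal (a\<^sup>2) * G\<^sup>2"
    using a by (simp add: power_mult_distrib ennreal_power)
  have gom: "ennreal (a\<^sup>2) * gom_objective M \<F> l X v + ennreal (l * c)
      = (ennreal a * G)\<^sup>2 + (ennreal (a\<^sup>2) * ennreal (l * (norm v)\<^sup>2) + ennreal (l * c))"
    unfolding sq by (simp add: gom_objective_def G_def distrib_left add.assoc)
  show "ennreal (a\<^sup>2) * gom_objective M \<F> l X v + ennreal (l * c)
         + ennreal (l * (norm (treated_block w - u))\<^sup>2) \<le> joint_objective M \<F> l T X w"
    using power_mono_ennreal[OF le, of 2]
    unfolding gom J norm r_def[symmetric] by (simp add: add.assoc add_right_mono)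
  show "joint_objective M \<F> l T X w = ennreal (a\<^sup>2) * gom_objective M \<F> l X v + ennreal (l * c)"
    if "treated_block w = u"
  proof -
    have "S = ennreal a * G" "r = 0"
      using le ge[OF that] that by (auto simp: r_def)
    then show ?thesis
      unfolding gom J norm by (simp add: add.assoc)
  qed
qed

subsection \<open>Existence and uniqueness of the GOM weights\<close>

lemma mem_minimizers_iff:
  fixes h :: "'a \<Rightarrow> 'b::linorder"
  shows "x \<in> minimizers h S \<longleftrightarrow> x \<in> S \<and> (\<forall>y\<in>S. h x \<le> h y)"
  by (auto simp: minimizers_def is_arg_min_def not_less)

text \<open>Minimizers in \<open>S\<close> are exactly the common points in \<open>S\<close> of the
  closed sublevel sets at the values \<open>h y\<close>, and compactness reduces nonemptiness to
  finitely many of these.\<close>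

lemma lower_semicontinuous_attains_inf:
  fixes h :: "'a::topological_space \<Rightarrow> 'b::linorder"
  assumes "compact S" "S \<noteq> {}" and closed: "\<And>c. closed {x. h x \<le> c}"
  shows "\<exists>x\<in>S. \<forall>y\<in>S. h x \<le> h y"
proof -
  have "S \<inter> (\<Inter>y\<in>S. {x. h x \<le> h y}) \<noteq> {}"
  proof (rule compact_imp_fip_image[OF assms(1)])
    fix I assume I: "finite I" "I \<subseteq> S"
    show "S \<inter> (\<Inter>y\<in>I. {x. h x \<le> h y}) \<noteq> {}"
    proof (cases "I = {}")
      case False
      \<comment> \<open>Sublevel sets are nested, so the point of \<open>I\<close> with least value
        lies in all of them.\<close>
      then obtain x where "x \<in> I" "\<forall>y\<in>I. h x \<le> h y"
        using ex_min_if_finite[of "h ` I"] I(1) by (fastforce simp: not_less)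
      then show ?thesis using I(2) by auto
    qed (use assms(2) in auto)
  qed (rule closed)
  then show ?thesis by auto
qed

lemma compact_weight_simplex: "compact (weight_simplex :: (real ^ 'm::finite) set)"
proof -
  have "norm w \<le> 1" if "w \<in> weight_simplex" for w :: "real ^ 'm"
    using norm_le_l1_cart[of w] that by (simp add: weight_simplex_def)
  moreover have "closed (weight_simplex :: (real ^ 'm) set)"
    unfolding weight_simplex_def
    by (intro closed_Collect_conj closed_Collect_all closed_Collect_le closed_Collect_eq
        continuous_intros)
  ultimately show ?thesis
    by (auto simp: compact_eq_bounded_closed bounded_iff)
qed

lemma weight_simplex_nonempty: "weight_simplex \<noteq> ({} :: (real ^ 'm::finite) set)"
proof -
  have "(\<chi> i. 1 / real CARD('m)) \<in> (weight_simplex :: (real ^ 'm) set)"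
    by (simp add: weight_simplex_def)
  then show ?thesis by blast
qed

text \<open>Turns a finite bound on an extended-valued objective into real inequalities, one per
  test function. These are closed conditions on the weights and survive averaging, which serves
  existence and uniqueness respectively.\<close>

lemma SUP_abs_power2_le_iff:
  fixes d :: "'f \<Rightarrow> real"
  assumes "\<F> \<noteq> {}" "0 \<le> b" "0 \<le> c"
  shows "(SUP f\<in>\<F>. ennreal \<bar>d f\<bar>)\<^sup>2 + ennreal b \<le> ennreal c \<longleftrightarrow> (\<forall>f\<in>\<F>. (d f)\<^sup>2 + b \<le> c)"
    (is "?S\<^sup>2 + _ \<le> _ \<longleftrightarrow> _")
proof
  assume le: "?S\<^sup>2 + ennreal b \<le> ennreal c"
  show "\<forall>f\<in>\<F>. (d f)\<^sup>2 + b \<le> c"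
  proof
    fix f assume "f \<in> \<F>"
    then have "(ennreal \<bar>d f\<bar>)\<^sup>2 + ennreal b \<le> ?S\<^sup>2 + ennreal b"
      by (intro add_right_mono power_mono_ennreal SUP_upper)
    also have "(ennreal \<bar>d f\<bar>)\<^sup>2 + ennreal b = ennreal ((d f)\<^sup>2 + b)"
      using assms(2) by (simp add: ennreal_power)
    finally have "ennreal ((d f)\<^sup>2 + b) \<le> ennreal c"
      using le by (rule order_trans)
    then show "(d f)\<^sup>2 + b \<le> c"
      using assms(3) by (simp add: ennreal_le_iff del: ennreal_plus)
  qed
next
  assume le: "\<forall>f\<in>\<F>. (d f)\<^sup>2 + b \<le> c"
  \<comment> \<open>With no test function the right side would be vacuous; any single one yields
    this, and it makes the square root below meaningful.\<close>
  then have "b \<le> c"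
    using assms(1) by (metis add_le_same_cancel2 ex_in_conv order_trans zero_le_power2 add_increasing order_refl)
  have "?S \<le> ennreal (sqrt (c - b))"
    using le by (intro SUP_least ennreal_leI real_le_rsqrt) (auto simp: le_diff_eq)
  then have "?S\<^sup>2 \<le> ennreal (c - b)"
    using power_mono_ennreal[of ?S _ 2] \<open>b \<le> c\<close> by (fastforce simp: ennreal_power)
  then have "?S\<^sup>2 + ennreal b \<le> ennreal (c - b) + ennreal b"
    by (rule add_right_mono)
  also have "\<dots> = ennreal c"
    using \<open>b \<le> c\<close> assms(2) by (simp flip: ennreal_plus)
  finally show "?S\<^sup>2 + ennreal b \<le> ennreal c" .
qed

lemma continuous_on_imbalance:
  "continuous_on A (\<lambda>v. imbalance X v f)"
  unfolding imbalance_def by (intro continuous_intros)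

lemma imbalance_midpoint:
  "imbalance X ((1/2) *\<^sub>R (u + v)) f = (imbalance X u f + imbalance X v f) / 2"
proof -
  have "(\<Sum>i\<in>UNIV. ((1/2) *\<^sub>R (u + v)) $ i * f (X (Inl i)))
      = ((\<Sum>i\<in>UNIV. u $ i * f (X (Inl i))) + (\<Sum>i\<in>UNIV. v $ i * f (X (Inl i)))) / 2"
    by (simp add: sum.distrib[symmetric] sum_divide_distrib algebra_simps add_divide_distrib)
  then show ?thesis
    unfolding imbalance_def by (simp only:) (simp add: field_simps)
qed

lemma gom_minimizer_exists:
  fixes X :: "'c::finite + 't::finite \<Rightarrow> 'x"
  assumes \<F>: "\<F> \<subseteq> borel_measurable M" "\<F> \<noteq> {}" and X: "\<And>i. X i \<in> space M" and l: "0 \<le> l"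
  shows "minimizers (gom_objective M \<F> l X) weight_simplex \<noteq> {}"
proof -
  \<comment> \<open>The supremum formula is used on the whole space, because closedness of sublevel
    sets is required there, while the objective is known to agree with it only for nonnegative
    weights.\<close>
  define h where "h v = (SUP f\<in>\<F>. ennreal \<bar>imbalance X v f\<bar>)\<^sup>2 + ennreal (l * (norm v)\<^sup>2)" for v
  have h: "gom_objective M \<F> l X v = h v" if "v \<in> weight_simplex" for v
    using that gom_ipm_eq_SUP[of \<F> M X v] \<F>(1) X
    by (simp add: gom_objective_def h_def weight_simplex_def)
  have "closed {v. h v \<le> c}" for c
  proof (cases c)
    case (real r)
    then have "{v. h v \<le> c} = {v. \<forall>f\<in>\<F>. (imbalance X v f)\<^sup>2 + l * (norm v)\<^sup>2 \<le> r}"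
      unfolding h_def using SUP_abs_power2_le_iff[OF \<F>(2), of _ r] l by simp
    then show ?thesis
      by (simp only: Ball_def)
         (intro closed_Collect_all closed_Collect_imp closed_Collect_le open_Collect_const
           continuous_intros continuous_on_imbalance)
  \<comment> \<open>The remaining level is infinite, and its sublevel set is the whole
    space.\<close>
  qed (simp add: h_def)
  from lower_semicontinuous_attains_inf[OF compact_weight_simplex weight_simplex_nonempty this]
  obtain v where "v \<in> weight_simplex" "\<forall>y\<in>weight_simplex. h v \<le> h y"
    by blast
  then have "v \<in> minimizers (gom_objective M \<F> l X) weight_simplex"
    by (simp add: mem_minimizers_iff h)
  then show ?thesis by blast
qed

text \<open>At the midpoint of two minimizers each squared imbalance is at most the average, while
  the penalty falls below its average by \<open>e\<close>. As the minimum is a real number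
  \<open>g\<close>, this forces \<open>e\<close> to vanish.\<close>

lemma gom_minimizer_unique:
  fixes X :: "'c::finite + 't::finite \<Rightarrow> 'x"
  assumes \<F>: "\<F> \<subseteq> borel_measurable M" "\<F> \<noteq> {}" and X: "\<And>i. X i \<in> space M" and l: "0 < l"
    and u: "u \<in> minimizers (gom_objective M \<F> l X) weight_simplex"
    and v: "v \<in> minimizers (gom_objective M \<F> l X) weight_simplex"
    and fin: "gom_objective M \<F> l X v < \<infinity>"
  shows "u = v"
proof -
  define m where "m = (1/2) *\<^sub>R (u + v)"
  have simplex: "u \<in> weight_simplex" "v \<in> weight_simplex"
    using u v by (auto simp: mem_minimizers_iff)
  then have m: "m \<in> weight_simplex"
    by (auto simp: m_def weight_simplex_def sum.distrib sum_distrib_left[symmetric]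
        sum_divide_distrib[symmetric])
  obtain g where g: "0 \<le> g" "gom_objective M \<F> l X v = ennreal g"
    using fin by (cases "gom_objective M \<F> l X v") auto
  have le: "gom_objective M \<F> l X w \<le> ennreal c \<longleftrightarrow>
      (\<forall>f\<in>\<F>. (imbalance X w f)\<^sup>2 + l * (norm w)\<^sup>2 \<le> c)" if "w \<in> weight_simplex" "0 \<le> c" for w c
    using that gom_ipm_eq_SUP[of \<F> M X w] \<F>(1) X SUP_abs_power2_le_iff[OF \<F>(2), of "l * (norm w)\<^sup>2" c] l
    by (simp add: gom_objective_def weight_simplex_def)
  have "gom_objective M \<F> l X u \<le> ennreal g" "gom_objective M \<F> l X v \<le> ennreal g"
    using u v g by (auto simp: mem_minimizers_iff)
  then have bound: "(imbalance X u f)\<^sup>2 + l * (norm u)\<^sup>2 \<le> g" "(imbalance X v f)\<^sup>2 + l * (norm v)\<^sup>2 \<le> g"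
    if "f \<in> \<F>" for f
    using that le simplex g(1) by auto
  \<comment> \<open>The gap in the parallelogram identity for the midpoint, scaled by
    \<open>l\<close>.\<close>
  define e where "e = l * (norm (u - v))\<^sup>2 / 4"
  have norm_m: "l * (norm m)\<^sup>2 = (l * (norm u)\<^sup>2 + l * (norm v)\<^sup>2) / 2 - e"
    unfolding m_def e_def power2_norm_eq_inner
    by (simp add: inner_simps inner_commute field_simps)
  have m_le: "(imbalance X m f)\<^sup>2 + l * (norm m)\<^sup>2 \<le> g - e" if "f \<in> \<F>" for f
  proof -
    have "(imbalance X m f)\<^sup>2 \<le> ((imbalance X u f)\<^sup>2 + (imbalance X v f)\<^sup>2) / 2"
      using sum_squares_bound[of "imbalance X u f" "imbalance X v f"]
      unfolding m_def imbalance_midpoint by (simp add: power2_eq_square field_simps)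
    then show ?thesis
      using bound[OF that] norm_m by argo
  qed
  obtain f0 where "f0 \<in> \<F>" using \<F>(2) by blast
  \<comment> \<open>Needed because \<open>ennreal\<close> would truncate a negative bound to
    0.\<close>
  have "0 \<le> g - e"
    using m_le[OF \<open>f0 \<in> \<F>\<close>] l by (meson add_nonneg_nonneg mult_nonneg_nonneg less_imp_le order_trans zero_le_power2)
  then have "gom_objective M \<F> l X m \<le> ennreal (g - e)"
    using le[OF m] m_le by blast
  moreover have "ennreal g \<le> gom_objective M \<F> l X m"
    using v m g by (auto simp: mem_minimizers_iff)
  ultimately have "g \<le> g - e"
    using \<open>0 \<le> g - e\<close> by (metis ennreal_le_iff order_trans)
  then show ?thesis
    using l by (simp add: e_def mult_le_0_iff)
qed

subsection \<open>Transfer between the two problems\<close>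

definition extend_uniform :: "real ^ 'c \<Rightarrow> real ^ ('c::finite + 't::finite)" where
  "extend_uniform v = (\<chi> i. case i of
     Inl k \<Rightarrow> real CARD('c) / real CARD('c + 't) * v $ k
   | Inr j \<Rightarrow> 1 / real CARD('c + 't))"

lemma control_block_extend_uniform [simp]:
  "control_block (extend_uniform v :: real ^ ('c::finite + 't::finite))
    = (real CARD('c) / real CARD('c + 't)) *\<^sub>R v"
  by (simp add: control_block_def extend_uniform_def vec_eq_iff)

lemma treated_block_extend_uniform [simp]:
  "treated_block (extend_uniform v :: real ^ ('c::finite + 't::finite))
    = (\<chi> j. 1 / real CARD('c + 't))"
  by (simp add: treated_block_def extend_uniform_def)

lemma extend_uniform_mem:
  fixes v :: "real ^ 'c::finite"
  assumes "v \<in> weight_simplex"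
  shows "(extend_uniform v :: real ^ ('c + 't::finite)) \<in> blockwise_simplex"
proof -
  have "0 \<le> (extend_uniform v :: real ^ ('c + 't)) $ i" for i
    using assms by (cases i) (auto simp: extend_uniform_def weight_simplex_def)
  then show ?thesis
    using assms by (simp add: blockwise_simplex_def weight_simplex_def
        sum_distrib_left[symmetric] sum_divide_distrib[symmetric] del: card_sum)
qed

text \<open>Lets both problems share the variable \<open>v\<close>. Rescaling by n/n0 is possible
  because finite types are inhabited, so n0 is positive.\<close>

lemma blockwise_simplex_control:
  fixes w :: "real ^ ('c::finite + 't::finite)"
  assumes "w \<in> blockwise_simplex"
  obtains v where "v \<in> weight_simplex"
    "control_block w = (real CARD('c) / real CARD('c + 't)) *\<^sub>R v"
proof
  let ?a = "real CARD('c) / real CARD('c + 't)"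
  have a: "0 < ?a"
    by (simp del: card_sum)
  have sum: "(\<Sum>i\<in>UNIV. control_block w $ i) = ?a" and nonneg: "0 \<le> control_block w $ i" for i
    using assms by (auto simp: blockwise_simplex_def control_block_def)
  have "(\<Sum>i\<in>UNIV. (inverse ?a *\<^sub>R control_block w) $ i) = inverse ?a * ?a"
    unfolding sum[symmetric] by (simp only: vector_scaleR_component real_scaleR_def sum_distrib_left)
  then show "inverse ?a *\<^sub>R control_block w \<in> weight_simplex"
    using a nonneg by (simp add: weight_simplex_def del: card_sum)
  show "control_block w = ?a *\<^sub>R (inverse ?a *\<^sub>R control_block w)"
    using a by (simp del: card_sum)
qed

text \<open>Only monotonicity of addition and multiplication in \<open>ennreal\<close> enters, with
  no cancellation, so the argument also covers infinite values.\<close>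

lemma joint_minimizer_of_gom_minimizer:
  fixes X :: "'c::finite + 't::finite \<Rightarrow> 'x"
  assumes \<F>: "\<F> \<subseteq> borel_measurable M" and X: "\<And>i. X i \<in> space M"
    and T0: "\<And>i. T (Inl i) = 0" and T1: "\<And>j. T (Inr j) = 1" and l: "0 \<le> l"
    and v: "v \<in> minimizers (gom_objective M \<F> l X) weight_simplex"
  shows "extend_uniform v \<in> minimizers (joint_objective M \<F> l T X) blockwise_simplex"
  unfolding mem_minimizers_iff
proof (intro conjI ballI)
  have simplex: "v \<in> weight_simplex"
    using v by (simp add: mem_minimizers_iff)
  then show mem: "(extend_uniform v :: real ^ ('c + 't)) \<in> blockwise_simplex"
    by (rule extend_uniform_mem)
  fix w :: "real ^ ('c + 't)" assume w: "w \<in> blockwise_simplex"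
  then obtain v' where v': "v' \<in> weight_simplex"
    "control_block w = (real CARD('c) / real CARD('c + 't)) *\<^sub>R v'"
    by (rule blockwise_simplex_control)
  let ?a = "ennreal ((real CARD('c) / real CARD('c + 't))\<^sup>2)"
  let ?c = "ennreal (l * (real CARD('t) / (real CARD('c + 't))\<^sup>2))"
  have "joint_objective M \<F> l T X (extend_uniform v) = ?a * gom_objective M \<F> l X v + ?c"
    using joint_objective_eq_gom[OF \<F> X T0 T1 l mem simplex] by simp
  also have "\<dots> \<le> ?a * gom_objective M \<F> l X v' + ?c"
    using v v'(1) by (intro add_right_mono mult_left_mono) (auto simp: mem_minimizers_iff)
  also have "\<dots> \<le> joint_objective M \<F> l T X w"
    by (rule order_trans[OF _ joint_objective_ge_gom[OF \<F> X T0 T1 l w v']]) simp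
  finally show "joint_objective M \<F> l T X (extend_uniform v) \<le> joint_objective M \<F> l T X w" .
qed

text \<open>Comparing \<open>w\<close> with the extension of a GOM minimizer gives
  \<open>a * g' + r \<le> a * g\<close>, while minimality gives \<open>g \<le> g'\<close>.
  Finiteness allows cancellation, so \<open>g' = g\<close> and the treated deviation
  \<open>r\<close> is zero.\<close>

lemma gom_minimizer_of_joint_minimizer:
  fixes X :: "'c::finite + 't::finite \<Rightarrow> 'x"
  assumes \<F>: "\<F> \<subseteq> borel_measurable M" and X: "\<And>i. X i \<in> space M"
    and T0: "\<And>i. T (Inl i) = 0" and T1: "\<And>j. T (Inr j) = 1" and l: "0 < l"
    and v: "v \<in> minimizers (gom_objective M \<F> l X) weight_simplex"
    and fin: "gom_objective M \<F> l X v < \<infinity>"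
    and w: "w \<in> minimizers (joint_objective M \<F> l T X) blockwise_simplex"
  obtains v' where "v' \<in> minimizers (gom_objective M \<F> l X) weight_simplex"
    and "w = extend_uniform v'"
proof -
  have l0: "0 \<le> l" using l by simp
  have simplex: "v \<in> weight_simplex" "w \<in> blockwise_simplex"
    using v w by (auto simp: mem_minimizers_iff)
  obtain v' where v': "v' \<in> weight_simplex"
    "control_block w = (real CARD('c) / real CARD('c + 't)) *\<^sub>R v'"
    using blockwise_simplex_control[OF simplex(2)] .
  define a where "a = (real CARD('c) / real CARD('c + 't))\<^sup>2"
  define c where "c = l * (real CARD('t) / (real CARD('c + 't))\<^sup>2)"
  define r where "r = l * (norm (treated_block w - (\<chi> j. 1 / real CARD('c + 't))))\<^sup>2"
  have pos: "0 < a" "0 \<le> c" "0 \<le> r"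
    using l by (simp_all add: a_def c_def r_def del: card_sum)
  note mem = extend_uniform_mem[OF simplex(1)]
  obtain g where g: "0 \<le> g" "gom_objective M \<F> l X v = ennreal g"
    using fin by (cases "gom_objective M \<F> l X v") auto
  have "ennreal a * gom_objective M \<F> l X v' + ennreal c + ennreal r \<le> joint_objective M \<F> l T X w"
    unfolding a_def c_def r_def by (rule joint_objective_ge_gom[OF \<F> X T0 T1 l0 simplex(2) v'])
  also have "\<dots> \<le> joint_objective M \<F> l T X (extend_uniform v)"
    using w mem by (auto simp: mem_minimizers_iff)
  also have "\<dots> = ennreal a * ennreal g + ennreal c"
    unfolding a_def c_def g(2)[symmetric]
    using joint_objective_eq_gom[OF \<F> X T0 T1 l0 mem simplex(1)] by simp
  also have "\<dots> = ennreal (a * g + c)"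
    using pos g by (simp add: ennreal_mult)
  finally have le: "ennreal a * gom_objective M \<F> l X v' + ennreal c + ennreal r \<le> ennreal (a * g + c)" .
  \<comment> \<open>An infinite value times the positive \<open>a\<close> would break the finite
    bound \<open>le\<close>.\<close>
  have "gom_objective M \<F> l X v' \<noteq> top"
    using le pos by (auto simp: ennreal_mult_top top_unique)
  then obtain g' where g': "0 \<le> g'" "gom_objective M \<F> l X v' = ennreal g'"
    by (cases "gom_objective M \<F> l X v'") auto
  have "ennreal (a * g' + c + r) \<le> ennreal (a * g + c)"
    using le pos g' by (simp add: ennreal_mult)
  then have real_le: "a * g' + r \<le> a * g"
    using pos g by (subst (asm) ennreal_le_iff) auto
  have "gom_objective M \<F> l X v \<le> gom_objective M \<F> l X v'"
    using v v'(1) by (simp add: mem_minimizers_iff)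
  then have "g \<le> g'"
    using g g' by simp
  then have "a * g \<le> a * g'"
    using pos by simp
  then have "a * g' = a * g" "r = 0"
    using real_le pos by linarith+
  then have "g' = g" "treated_block w = (\<chi> j. 1 / real CARD('c + 't))"
    using pos l by (auto simp: r_def)
  then have "v' \<in> minimizers (gom_objective M \<F> l X) weight_simplex" "w = extend_uniform v'"
    using v v' g g' by (auto simp: mem_minimizers_iff intro: blocks_eqI)
  then show thesis by (rule that)
qed

subsection \<open>The weighted least squares fit\<close>

text \<open>The cross term vanishes because \<open>m\<close> is a weighted mean. The mean is
  characterized by a product rather than a quotient, so no division by the total weight
  occurs.\<close>

lemma weighted_sum_squares_shift:
  fixes p y :: "'i \<Rightarrow> real"
  assumes "(\<Sum>i\<in>A. p i * y i) = (\<Sum>i\<in>A. p i) * m"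
  shows "(\<Sum>i\<in>A. p i * (y i - c)\<^sup>2) = (\<Sum>i\<in>A. p i * (y i - m)\<^sup>2) + (\<Sum>i\<in>A. p i) * (c - m)\<^sup>2"
proof -
  have "(\<Sum>i\<in>A. p i * (y i - c)\<^sup>2)
      = (\<Sum>i\<in>A. p i * (y i - m)\<^sup>2 + p i * (c - m)\<^sup>2 + 2 * (m - c) * (p i * y i - p i * m))"
    by (intro sum.cong refl) (simp add: power2_eq_square algebra_simps)
  also have "\<dots> = (\<Sum>i\<in>A. p i * (y i - m)\<^sup>2) + (\<Sum>i\<in>A. p i) * (c - m)\<^sup>2
      + 2 * (m - c) * ((\<Sum>i\<in>A. p i * y i) - (\<Sum>i\<in>A. p i) * m)"
    unfolding sum_distrib_right sum_subtractf[symmetric] sum_distrib_left sum.distrib ..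
  finally show ?thesis
    using assms by simp
qed

text \<open>The arms have positive masses \<open>a\<close> and \<open>b\<close>, which cancel in the
  weighted means. The loss splits into one quadratic per arm with these leading coefficients, so the
  two means are its only minimizer.\<close>

lemma extend_uniform_estimator:
  fixes v :: "real ^ 'c::finite" and Y :: "'c + 't::finite \<Rightarrow> real"
  defines "w \<equiv> extend_uniform v :: real ^ ('c + 't)"
  assumes v: "v \<in> weight_simplex"
    and T0: "\<And>i. T (Inl i) = 0" and T1: "\<And>j. T (Inr j) = 1"
  shows extend_uniform_weighted_mean:
      "t \<in> {0, 1} \<Longrightarrow>
       gom_estimator Y v t = (\<Sum>i | T i = t. w $ i * Y i) / (\<Sum>i | T i = t. w $ i)"
    and extend_uniform_square_loss_minimizers:
      "minimizers (weighted_square_loss T Y w) ({0, 1} \<rightarrow>\<^sub>E UNIV) = {gom_estimator Y v}"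
proof -
  define a b where "a = real CARD('c) / real CARD('c + 't)" and "b = real CARD('t) / real CARD('c + 't)"
  have ab: "0 < a" "0 < b"
    by (simp_all add: a_def b_def del: card_sum)
  define m where "m = gom_estimator Y v"
  have wl: "w $ Inl i = a * v $ i" and wr: "w $ Inr j = 1 / real CARD('c + 't)" for i j
    by (simp_all add: w_def extend_uniform_def a_def)
  have sl: "(\<Sum>i\<in>UNIV. w $ Inl i) = a"
    using v by (simp add: wl sum_distrib_left[symmetric] weight_simplex_def)
  have sr: "(\<Sum>j\<in>UNIV. w $ Inr j) = b"
    by (simp add: wr b_def)
  have ml: "(\<Sum>i\<in>UNIV. w $ Inl i * Y (Inl i)) = (\<Sum>i\<in>UNIV. w $ Inl i) * m 0"
    unfolding sl by (simp add: wl m_def gom_estimator_def sum_distrib_left mult.assoc)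
  have mr: "(\<Sum>j\<in>UNIV. w $ Inr j * Y (Inr j)) = (\<Sum>j\<in>UNIV. w $ Inr j) * m 1"
    unfolding sr by (simp add: wr m_def gom_estimator_def b_def sum_divide_distrib[symmetric])
  \<comment> \<open>Puts the group sum over the full index type, where it can be split into the two
    blocks.\<close>
  have T_sum: "(\<Sum>i | T i = t. f i) = (\<Sum>i\<in>UNIV. if T i = t then f i else 0)"
    for f :: "'c + 't \<Rightarrow> real" and t
    by (simp add: sum.If_cases Collect_conv_if)
  show "gom_estimator Y v t = (\<Sum>i | T i = t. w $ i * Y i) / (\<Sum>i | T i = t. w $ i)"
    if "t \<in> {0, 1}"
    using that ab unfolding T_sum
    by (auto simp: sum_UNIV_sum_type T0 T1 ml mr sl sr m_def[symmetric])
  define k where "k = (\<Sum>i\<in>UNIV. w $ Inl i * (Y (Inl i) - m 0)\<^sup>2) + (\<Sum>j\<in>UNIV. w $ Inr j * (Y (Inr j) - m 1)\<^sup>2)"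
  have loss: "weighted_square_loss T Y w g = k + a * (g 0 - m 0)\<^sup>2 + b * (g 1 - m 1)\<^sup>2" for g
    unfolding weighted_square_loss_def sum_UNIV_sum_type T0 T1
      weighted_sum_squares_shift[OF ml, of "g 0"] weighted_sum_squares_shift[OF mr, of "g 1"] sl sr k_def by simp
  \<comment> \<open>The estimator is a restricted function, undefined outside the two arms; hence
    agreement at 0 and 1 means equality.\<close>
  have ext: "m \<in> {0, 1} \<rightarrow>\<^sub>E UNIV"
    by (simp add: m_def gom_estimator_def)
  have "minimizers (weighted_square_loss T Y w) ({0, 1} \<rightarrow>\<^sub>E UNIV) = {m}"
  proof (intro equalityI subsetI)
    fix g assume "g \<in> minimizers (weighted_square_loss T Y w) ({0, 1} \<rightarrow>\<^sub>E UNIV)"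
    then have g: "g \<in> {0, 1} \<rightarrow>\<^sub>E UNIV"
      and "weighted_square_loss T Y w g \<le> weighted_square_loss T Y w m"
      using ext by (auto simp: mem_minimizers_iff)
    then have "a * (g 0 - m 0)\<^sup>2 + b * (g 1 - m 1)\<^sup>2 \<le> 0"
      by (simp add: loss)
    moreover have "0 \<le> a * (g 0 - m 0)\<^sup>2" "0 \<le> b * (g 1 - m 1)\<^sup>2"
      using ab by simp_all
    ultimately have "a * (g 0 - m 0)\<^sup>2 = 0" "b * (g 1 - m 1)\<^sup>2 = 0"
      by linarith+
    then have "g 0 = m 0" "g 1 = m 1"
      using ab by simp_all
    then have "g = m"
      using g ext by (intro PiE_ext) auto
    then show "g \<in> {m}" by simp
  next
    fix g assume "g \<in> {m}"
    then show "g \<in> minimizers (weighted_square_loss T Y w) ({0, 1} \<rightarrow>\<^sub>E UNIV)"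
      using ext ab by (auto simp: mem_minimizers_iff loss)
  qed
  then show "minimizers (weighted_square_loss T Y w) ({0, 1} \<rightarrow>\<^sub>E UNIV) = {gom_estimator Y v}"
    by (simp add: m_def)
qed

text \<open>Over an arbitrary unit ball the discrepancy may be infinite for all weights, so
  existence and uniqueness are claimed when it is finite somewhere. The equalities are claimed
  whenever both minimizers are unique, and for them the transfer from GOM to the joint problem
  suffices.\<close>

theorem proposition2:
  fixes M :: "'x measure"
    and V :: "('x \<Rightarrow> real) set" and N :: "('x \<Rightarrow> real) \<Rightarrow> real"
    and \<F>\<^sub>0 :: "('x \<Rightarrow> real) set"
    and T :: "'c::finite + 't::finite \<Rightarrow> nat"
    and X :: "'c + 't \<Rightarrow> 'x"
    and Y :: "'c + 't \<Rightarrow> real"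
    and l :: real
  assumes "normed_function_space V N"
    and "V \<subseteq> borel_measurable M"
    and "\<F>\<^sub>0 = function_unit_ball V N"
    and "\<And>i. T (Inl i) = 0" and "\<And>j. T (Inr j) = 1"
    and "\<And>i. X i \<in> space M"
    and "l > 0"
  shows "((\<exists>v\<in>weight_simplex. gom_ipm M \<F>\<^sub>0 X v < \<infinity>) \<longrightarrow>
            (\<exists>w. minimizers (joint_objective M \<F>\<^sub>0 l T X) blockwise_simplex = {w}) \<and>
            (\<exists>v. minimizers (gom_objective M \<F>\<^sub>0 l X) weight_simplex = {v})) \<and>
         (\<forall>w v.
            minimizers (joint_objective M \<F>\<^sub>0 l T X) blockwise_simplex = {w} \<longrightarrow>
            minimizers (gom_objective M \<F>\<^sub>0 l X) weight_simplex = {v} \<longrightarrow>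
            control_block w = (real CARD('c) / real CARD('c + 't)) *\<^sub>R v \<and>
            treated_block w = (\<chi> j. 1 / real CARD('c + 't)) \<and>
            minimizers (weighted_square_loss T Y w) ({0, 1} \<rightarrow>\<^sub>E UNIV) = {gom_estimator Y v} \<and>
            (\<forall>t\<in>{0, 1}. gom_estimator Y v t =
               (\<Sum>i | T i = t. w $ i * Y i) / (\<Sum>i | T i = t. w $ i)))"
proof -
  interpret normed_function_space V N by fact
  have \<F>: "\<F>\<^sub>0 \<subseteq> borel_measurable M"
    using assms(2,3) by (auto simp: function_unit_ball_def)
  \<comment> \<open>The zero function lies in the unit ball, which is therefore nonempty.\<close>
  have "N (\<lambda>_. 0) = 0"
    using norm_eq_zero_iff[OF zero_mem] by simp
  then have nonempty: "\<F>\<^sub>0 \<noteq> {}"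
    using zero_mem assms(3) by (auto simp: function_unit_ball_def)
  note X = assms(6)
  let ?J = "minimizers (joint_objective M \<F>\<^sub>0 l T X) blockwise_simplex"
  let ?G = "minimizers (gom_objective M \<F>\<^sub>0 l X) weight_simplex"
  have gom_to_joint: "extend_uniform v \<in> ?J" if "v \<in> ?G" for v
    using joint_minimizer_of_gom_minimizer[OF \<F> X assms(4,5) _ that] assms(7) by simp
  show ?thesis
  proof (intro conjI impI allI)
    assume "\<exists>v\<in>weight_simplex. gom_ipm M \<F>\<^sub>0 X v < \<infinity>"
    then obtain v0 where v0: "v0 \<in> weight_simplex" "gom_objective M \<F>\<^sub>0 l X v0 < \<infinity>"
      by (auto simp: gom_objective_def power2_eq_square ennreal_mult_less_top)
    have "?G \<noteq> {}"
      by (rule gom_minimizer_exists[OF \<F> nonempty X]) (use assms(7) in simp)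
    then obtain v where v: "v \<in> ?G"
      by blast
    then have fin: "gom_objective M \<F>\<^sub>0 l X v < \<infinity>"
      using v0 by (auto simp: mem_minimizers_iff intro: le_less_trans)
    have G: "?G = {v}"
      using gom_minimizer_unique[OF \<F> nonempty X assms(7) _ v fin] v by blast
    then show "\<exists>v. ?G = {v}" by blast
    have "w = extend_uniform v" if "w \<in> ?J" for w
      using gom_minimizer_of_joint_minimizer[OF \<F> X assms(4,5,7) v fin that] G by blast
    then show "\<exists>w. ?J = {w}"
      using gom_to_joint[OF v] by blast
  next
    fix w v assume J: "?J = {w}" and G: "?G = {v}"
    \<comment> \<open>The extension of \<open>v\<close> is a joint minimizer, and \<open>w\<close>
      is the only one.\<close>
    then have w: "w = extend_uniform v"
      using gom_to_joint[of v] by auto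
    have v: "v \<in> weight_simplex"
      using G mem_minimizers_iff[of v "gom_objective M \<F>\<^sub>0 l X" weight_simplex] by blast
    show "control_block w = (real CARD('c) / real CARD('c + 't)) *\<^sub>R v"
      "treated_block w = (\<chi> j. 1 / real CARD('c + 't))"
      unfolding w by (rule control_block_extend_uniform treated_block_extend_uniform)+
    show "minimizers (weighted_square_loss T Y w) ({0, 1} \<rightarrow>\<^sub>E UNIV) = {gom_estimator Y v}"
      unfolding w by (rule extend_uniform_square_loss_minimizers[OF v assms(4,5)])
    show "\<forall>t\<in>{0, 1}. gom_estimator Y v t =
        (\<Sum>i | T i = t. w $ i * Y i) / (\<Sum>i | T i = t. w $ i)"
      unfolding w using extend_uniform_weighted_mean[OF v assms(4,5)] by blast
  qed
qed

end
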